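(* Let $(X,r)$ be a right-non-degenerate (RND) solution, and let $k$ be a reflection for $(X,r)$. Then for all $n\in\mathbb{N}$ and all $1\le i<n$ one has the following equalities of maps $X^n\to X^n$: $$J^{n;k}\, r_i = r^{(k)}_i\, J^{n;k},$$ $$\Delta^{n;k}\, r_i = r_{n-i}\,\Delta^{n;k}.$$
   Context: Products of maps denote composition, the rightmost map being applied first. For a map $\phi\colon X^m\to X^m$, $\phi_i$ denotes the map on $X^n$ that applies $\phi$ to the $m$ consecutive coordinates starting at position $i$ and is the identity on the others. A solution $(X,r)$ is a set $X$ with a map $r\colon X\times X\to X\times X$ (not assumed bijective) satisfying the Yang–Baxter equation $r_1r_2r_1=r_2r_1r_2$ on $X^3$; write $r(a,b)=(\lambda_a(b),\rho_b(a))$. It is right-non-degenerate (RND) if all maps $\rho_b\colon X\to X$ are bijective. A reflection for $(X,r)$ is a map $k\colon X\to X$ with $r k_2 r k_2=k_2 r k_2 r$ on $X^2$. For an RND solution and a reflection $k$, the $k$-derived solution is the map $r^{(k)}\colon X\times X\to X\times X$, $r^{(k)}(a,b)=(b',a')$, where $a'=\rho_b\rho_{k(b)}^{-1}(a)$ and $b'=\rho_{k(a')}\lambda_{\rho_{k(b)}^{-1}(a)}(b)$. The $k$-Garside maps $\Delta^{n;k}\colon X^n\to X^n$ are $$\Delta^{n;k}=k_n\,(r_{n-1}\cdots r_2r_1)\,k_n\cdots k_n\,(r_{n-1}r_{n-2})\,k_n\,r_{n-1}\,k_n,$$ that is, $\Delta^{1;k}=k$ and $\Delta^{n;k}=k_n\,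 r_{n-1}\cdots r_2 r_1\,(\mathrm{Id}_X\times\Delta^{n-1;k})$ for $n\ge 2$. Put $\rho_{(b_1,\ldots,b_m)}=\rho_{b_m}\cdots\rho_{b_2}\rho_{b_1}$. The $k$-guitar maps $J^{n;k}\colon X^n\to X^n$ send $(a_1,\ldots,a_n)$ to $$\bigl(\rho_{\Delta^{n-1;k}(a_2,\ldots,a_n)}(a_1),\ \rho_{\Delta^{n-2;k}(a_3,\ldots,a_n)}(a_2),\ \ldots,\ \rho_{\Delta^{2;k}(a_{n-1},a_n)}(a_{n-2}),\ \rho_{k(a_n)}(a_{n-1}),\ a_n\bigr).$$ *)

theory Defs
  imports Main
begin

text \<open>
  The set \<open>X\<close> is the type \<open>'a\<close>; elements of \<open>X\<^sup>n\<close> are lists of length \<open>n\<close>.  Coordinates are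
  numbered from 1.
\<close>

text \<open>\<open>at_pos m \<phi> i\<close> is the map \<open>\<phi>\<^sub>i\<close> for \<open>\<phi>\<close> on \<open>X\<^sup>m\<close>; it is only meant for
  \<open>1 \<le> i\<close> and \<open>i + m - 1 \<le> length xs\<close>.\<close>

definition at_pos :: "nat \<Rightarrow> ('a list \<Rightarrow> 'a list) \<Rightarrow> nat \<Rightarrow> 'a list \<Rightarrow> 'a list" where
  "at_pos m \<phi> i xs =
     take (i - 1) xs @ \<phi> (take m (drop (i - 1) xs)) @ drop (i - 1 + m) xs"

definition at1 :: "('a \<Rightarrow> 'a) \<Rightarrow> nat \<Rightarrow> 'a list \<Rightarrow> 'a list" where
  "at1 k = at_pos 1 (\<lambda>xs. [k (xs ! 0)])"

definition at2 :: "('a \<times> 'a \<Rightarrow> 'a \<times> 'a) \<Rightarrow> nat \<Rightarrow> 'a list \<Rightarrow> 'a list" where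
  "at2 r = at_pos 2 (\<lambda>xs. [fst (r (xs ! 0, xs ! 1)), snd (r (xs ! 0, xs ! 1))])"

definition yb_solution :: "('a \<times> 'a \<Rightarrow> 'a \<times> 'a) \<Rightarrow> bool" where
  "yb_solution r \<longleftrightarrow>
     (\<forall>xs. length xs = 3 \<longrightarrow>
        (at2 r 1 \<circ> at2 r 2 \<circ> at2 r 1) xs = (at2 r 2 \<circ> at2 r 1 \<circ> at2 r 2) xs)"

text \<open>\<open>r (a, b) = (lam r a b, rho r b a)\<close>; mind the order of arguments of \<open>rho\<close>.\<close>

definition lam :: "('a \<times> 'a \<Rightarrow> 'a \<times> 'a) \<Rightarrow> 'a \<Rightarrow> 'a \<Rightarrow> 'a" where
  "lam r a b = fst (r (a, b))"

definition rho :: "('a \<times> 'a \<Rightarrow> 'a \<times> 'a) \<Rightarrow> 'a \<Rightarrow> 'a \<Rightarrow> 'a" where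
  "rho r b a = snd (r (a, b))"

definition right_nondegenerate :: "('a \<times> 'a \<Rightarrow> 'a \<times> 'a) \<Rightarrow> bool" where
  "right_nondegenerate r \<longleftrightarrow> (\<forall>b. bij (rho r b))"

definition reflection :: "('a \<times> 'a \<Rightarrow> 'a \<times> 'a) \<Rightarrow> ('a \<Rightarrow> 'a) \<Rightarrow> bool" where
  "reflection r k \<longleftrightarrow>
     (\<forall>xs. length xs = 2 \<longrightarrow>
        (at2 r 1 \<circ> at1 k 2 \<circ> at2 r 1 \<circ> at1 k 2) xs =
        (at1 k 2 \<circ> at2 r 1 \<circ> at1 k 2 \<circ> at2 r 1) xs)"

text \<open>The inverses below are genuine inverses when \<open>r\<close> is right-non-degenerate.\<close>

definition derived_solution ::
  "('a \<times> 'a \<Rightarrow> 'a \<times> 'a) \<Rightarrow> ('a \<Rightarrow> 'a) \<Rightarrow> 'a \<times> 'a \<Rightarrow> 'a \<times> 'a" where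
  "derived_solution r k = (\<lambda>(a, b).
     let a' = rho r b (inv (rho r (k b)) a);
         b' = rho r (k a') (lam r (inv (rho r (k b)) a) b)
     in (b', a'))"

text \<open>\<open>garside r k n\<close> is \<open>\<Delta>\<^bsup>n;k\<^esup>\<close>.  The \<open>fold\<close> is the composite \<open>r\<^bsub>n-1\<^esub> \<cdots> r\<^sub>2 r\<^sub>1\<close>, with \<open>r\<^sub>1\<close> applied
  first, and \<open>at_pos (n - 1) \<phi> 2\<close> is \<open>Id \<times> \<phi>\<close>.  The value at 0 is the identity of \<open>X\<^sup>0\<close>.\<close>

fun garside :: "('a \<times> 'a \<Rightarrow> 'a \<times> 'a) \<Rightarrow> ('a \<Rightarrow> 'a) \<Rightarrow> nat \<Rightarrow> 'a list \<Rightarrow> 'a list" where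
  "garside r k 0 = id"
| "garside r k (Suc 0) = at1 k 1"
| "garside r k (Suc (Suc m)) =
     at1 k (Suc (Suc m)) \<circ> fold (at2 r) [1..<Suc (Suc m)] \<circ> at_pos (Suc m) (garside r k (Suc m)) 2"

text \<open>\<open>rho_list r [b\<^sub>1, \<dots>, b\<^sub>m] = \<rho>\<^bsub>b\<^sub>m\<^esub> \<cdots> \<rho>\<^bsub>b\<^sub>1\<^esub>\<close>, the identity for the empty list.\<close>

definition rho_list :: "('a \<times> 'a \<Rightarrow> 'a \<times> 'a) \<Rightarrow> 'a list \<Rightarrow> 'a \<Rightarrow> 'a" where
  "rho_list r bs = fold (rho r) bs"

text \<open>\<open>guitar r k n\<close> is \<open>J\<^bsup>n;k\<^esup>\<close>.  Its \<open>j\<close>-th coordinate is \<open>a\<^sub>j\<close> acted on by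
  \<open>\<Delta>\<^bsup>n-j;k\<^esup>(a\<^bsub>j+1\<^esub>, \<dots>, a\<^sub>n)\<close>; for \<open>j = n\<close> this is \<open>a\<^sub>n\<close>.\<close>

definition guitar :: "('a \<times> 'a \<Rightarrow> 'a \<times> 'a) \<Rightarrow> ('a \<Rightarrow> 'a) \<Rightarrow> nat \<Rightarrow> 'a list \<Rightarrow> 'a list" where
  "guitar r k n as =
     map (\<lambda>j. rho_list r (garside r k (n - j) (drop j as)) (as ! (j - 1))) [1..<Suc n]"

end

theory Submission
  imports Defs
begin

text \<open>
  Passing \<open>a\<close> through \<open>bs\<close> by \<open>r\<^sub>m \<cdots> r\<^sub>1\<close> yields a word \<open>lam_list r a bs\<close> followed by the
  single element \<open>rho_list r bs a\<close>.  In these terms, with \<open>g = \<Delta>(as)\<close>, one has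
  \<open>\<Delta>(a # as) = lam_list r a g @ [k (rho_list r g a)]\<close> and
  \<open>J(a # as) = rho_list r g a # J(as)\<close>,
  so both maps are governed by how elements pass through words.  The Yang--Baxter equation extends
  from letters to words in two ways: passing \<open>a\<close> through a word commutes with applying \<open>r\<close> inside
  the word (\<open>lam_list_at2\<close>, \<open>rho_list_at2\<close>), and passing the two letters of a pair through a word
  commutes with applying \<open>r\<close> to the pair (\<open>lam_list_pair\<close>, \<open>rho_list_pair\<close>).

  The first fact reduces both equalities to the case \<open>i = 1\<close>, by removing the letters in front.
  For \<open>i = 1\<close>, let \<open>(c, d) = r (a, b)\<close> and \<open>g = \<Delta>(as)\<close>.  By the second fact,
  passing \<open>(a, b)\<close> or \<open>(c, d)\<close> through \<open>g\<close> leaves the same word behind, and the pairs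
  \<open>(a\<^sub>2, b\<^sub>1)\<close> and \<open>(c\<^sub>2, d\<^sub>1)\<close> that come out satisfy \<open>(c\<^sub>2, d\<^sub>1) = r (a\<^sub>2, b\<^sub>1)\<close>.
  The last two entries of \<open>\<Delta>(a, b, as)\<close> are \<open>k\<^sub>2 r k\<^sub>2 (a\<^sub>2, b\<^sub>1)\<close>, so the equality for
  \<open>\<Delta>\<close> is exactly the reflection equation.  The first two entries of \<open>J(a, b, as)\<close> are
  \<open>(\<rho>\<^bsub>k(b\<^sub>1)\<^esub>(a\<^sub>2), b\<^sub>1)\<close>.  The derived solution is \<open>r\<close> conjugated by
  \<open>(x, y) \<mapsto> (\<rho>\<^bsub>k(y)\<^esub>(x), y)\<close>, a map that right non-degeneracy makes invertible; hence the
  equality for \<open>J\<close>.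
\<close>

section \<open>Applying a map at a position of a word\<close>

lemma at2_append_Cons:
  "at2 r (Suc (length pre)) (pre @ x # y # zs) = pre @ lam r x y # rho r y x # zs"
  by (simp add: at2_def at_pos_def lam_def rho_def)

lemma at2_first: "at2 r (Suc 0) (x # y # zs) = lam r x y # rho r y x # zs"
  using at2_append_Cons[of r "[]"] by simp

lemma at2_index_cases:
  assumes "1 \<le> i" "i < length xs"
  obtains pre x y zs where "xs = pre @ x # y # zs" "i = Suc (length pre)"
proof
  show "xs = take (i - 1) xs @ xs ! (i - 1) # xs ! i # drop (Suc i) xs"
    using assms
    by (metis Cons_nth_drop_Suc Suc_pred' append_take_drop_id less_imp_diff_less
        less_le_trans zero_less_one)
  show "i = Suc (length (take (i - 1) xs))"
    using assms by simp
qed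

lemma at2_Cons:
  assumes "1 \<le> i" "i < length xs"
  shows "at2 r (Suc i) (a # xs) = a # at2 r i xs"
proof -
  obtain pre x y zs where "xs = pre @ x # y # zs" "i = Suc (length pre)"
    using at2_index_cases[OF assms] .
  then show ?thesis
    using at2_append_Cons[of r "a # pre"] by (simp add: at2_append_Cons)
qed

lemma at2_append:
  assumes "1 \<le> i" "i < length xs"
  shows "at2 r i (xs @ ys) = at2 r i xs @ ys"
proof -
  obtain pre x y zs where "xs = pre @ x # y # zs" "i = Suc (length pre)"
    using at2_index_cases[OF assms] .
  then show ?thesis
    by (simp add: at2_append_Cons)
qed

section \<open>Passing an element through a word\<close>

fun lam_list :: "('a \<times> 'a \<Rightarrow> 'a \<times> 'a) \<Rightarrow> 'a \<Rightarrow> 'a list \<Rightarrow> 'a list" where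
  "lam_list r a [] = []"
| "lam_list r a (b # bs) = lam r a b # lam_list r (rho r b a) bs"

lemma rho_list_Nil [simp]: "rho_list r [] a = a"
  by (simp add: rho_list_def)

lemma rho_list_Cons [simp]: "rho_list r (b # bs) a = rho_list r bs (rho r b a)"
  by (simp add: rho_list_def)

lemma rho_list_append [simp]: "rho_list r (bs @ cs) a = rho_list r cs (rho_list r bs a)"
  by (simp add: rho_list_def)

lemma length_lam_list [simp]: "length (lam_list r a bs) = length bs"
  by (induction bs arbitrary: a) auto

lemma lam_list_append [simp]:
  "lam_list r a (bs @ cs) = lam_list r a bs @ lam_list r (rho_list r bs a) cs"
  by (induction bs arbitrary: a) auto

text \<open>The prefix \<open>pre\<close> makes the induction go through: it collects the letters already passed.\<close>

lemma fold_at2_eq_lam_list_rho_list: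
  "fold (at2 r) [Suc (length pre)..<Suc (length pre) + length bs] (pre @ a # bs) =
     pre @ lam_list r a bs @ [rho_list r bs a]"
proof (induction bs arbitrary: pre a)
  case Nil
  then show ?case by simp
next
  case (Cons b bs)
  have "[Suc (length pre)..<Suc (length pre) + length (b # bs)] =
      Suc (length pre) # [Suc (length (pre @ [lam r a b]))
        ..<Suc (length (pre @ [lam r a b])) + length bs]"
    by (simp add: upt_conv_Cons del: upt_Suc)
  then show ?case
    using Cons.IH[of "pre @ [lam r a b]" "rho r b a"]
    by (simp add: at2_append_Cons del: upt_Suc)
qed

section \<open>The Yang--Baxter and reflection equations on words\<close>

lemma yb_solution_coordinates:
  assumes "yb_solution r"
  shows "lam r (lam r a b) (lam r (rho r b a) c) = lam r a (lam r b c)"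
    and "rho r (lam r (rho r b a) c) (lam r a b) = lam r (rho r (lam r b c) a) (rho r c b)"
    and "rho r c (rho r b a) = rho r (rho r c b) (rho r (lam r b c) a)"
proof -
  have at2_second: "at2 r 2 [x, y, z] = [x, lam r y z, rho r z y]" for x y z
    using at2_append_Cons[of r "[x]" y z "[]"] by (simp add: numeral_2_eq_2)
  have "(at2 r 1 \<circ> at2 r 2 \<circ> at2 r 1) [a, b, c] = (at2 r 2 \<circ> at2 r 1 \<circ> at2 r 2) [a, b, c]"
    using assms unfolding yb_solution_def by simp
  then show "lam r (lam r a b) (lam r (rho r b a) c) = lam r a (lam r b c)"
    and "rho r (lam r (rho r b a) c) (lam r a b) = lam r (rho r (lam r b c) a) (rho r c b)"
    and "rho r c (rho r b a) = rho r (rho r c b) (rho r (lam r b c) a)"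
    by (simp_all add: at2_first at2_second)
qed

lemma reflection_coordinates:
  assumes "reflection r k"
  \<comment> \<open>\<open>(u, v) = k\<^sub>2 r k\<^sub>2\<close>, so the reflection equation says that \<open>(u, v)\<close> commutes with \<open>r\<close>\<close>
  defines "u \<equiv> \<lambda>x y. lam r x (k y)" and "v \<equiv> \<lambda>x y. k (rho r (k y) x)"
  shows "lam r (u x y) (v x y) = u (lam r x y) (rho r y x)"
    and "rho r (v x y) (u x y) = v (lam r x y) (rho r y x)"
proof -
  have at1_second: "at1 k 2 [p, q] = [p, k q]" for p q
    by (simp add: at1_def at_pos_def)
  have "(at2 r 1 \<circ> at1 k 2 \<circ> at2 r 1 \<circ> at1 k 2) [x, y] =
      (at1 k 2 \<circ> at2 r 1 \<circ> at1 k 2 \<circ> at2 r 1) [x, y]"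
    using assms unfolding reflection_def by simp
  then show "lam r (u x y) (v x y) = u (lam r x y) (rho r y x)"
    and "rho r (v x y) (u x y) = v (lam r x y) (rho r y x)"
    by (simp_all add: at2_first at1_second u_def v_def)
qed

lemma rho_list_at2:
  assumes "yb_solution r" "1 \<le> i" "i < length bs"
  shows "rho_list r (at2 r i bs) a = rho_list r bs a"
proof -
  obtain pre x y zs where "bs = pre @ x # y # zs" "i = Suc (length pre)"
    using at2_index_cases[OF assms(2,3)] .
  then show ?thesis
    by (simp add: at2_append_Cons
        yb_solution_coordinates(3)[OF assms(1), of y x "rho_list r pre a"])
qed

lemma lam_list_at2:
  assumes "yb_solution r" "1 \<le> i" "i < length bs"
  shows "lam_list r a (at2 r i bs) = at2 r i (lam_list r a bs)"
proof -
  obtain pre x y zs where bs: "bs = pre @ x # y # zs" and i: "i = Suc (length pre)"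
    using at2_index_cases[OF assms(2,3)] .
  define c where "c = rho_list r pre a"
  have "at2 r i (lam_list r a bs) =
      lam_list r a pre @ lam r (lam r c x) (lam r (rho r x c) y)
        # rho r (lam r (rho r x c) y) (lam r c x) # lam_list r (rho r y (rho r x c)) zs"
    using at2_append_Cons[of r "lam_list r a pre"] by (simp add: bs i c_def)
  then show ?thesis
    by (simp add: bs i at2_append_Cons flip: c_def)
      (simp add: yb_solution_coordinates[OF assms(1), where a = c and b = x and c = y])
qed

lemma lam_list_pair:
  assumes "yb_solution r"
  shows "lam_list r (lam r a b) (lam_list r (rho r b a) xs) = lam_list r a (lam_list r b xs)"
proof (induction xs arbitrary: a b)
  case (Cons x xs)
  show ?case
    using Cons[of "rho r (lam r b x) a" "rho r x b"]
    by (simp add: yb_solution_coordinates[OF assms, where a = a and b = b and c = x])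
qed simp

text \<open>Jointly the two equations below say that \<open>r\<close> maps the pair left over from \<open>(a, b)\<close> to the pair left
  over from \<open>r (a, b)\<close>.\<close>

lemma rho_list_pair:
  assumes "yb_solution r"
  shows "rho_list r (lam_list r (rho r b a) xs) (lam r a b) =
      lam r (rho_list r (lam_list r b xs) a) (rho_list r xs b)"
    and "rho_list r xs (rho r b a) =
      rho r (rho_list r xs b) (rho_list r (lam_list r b xs) a)"
proof (induction xs arbitrary: a b)
  case (Cons x xs)
  {
    case 1
    show ?case
      using Cons(1)[of "rho r x b" "rho r (lam r b x) a"]
      by (simp add: yb_solution_coordinates[OF assms, where a = a and b = b and c = x])
  next
    case 2
    show ?case
      using Cons(2)[of "rho r x b" "rho r (lam r b x) a"]
      by (simp add: yb_solution_coordinates[OF assms, where a = a and b = b and c = x])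
  }
qed simp_all

section \<open>Recursion for the Garside and guitar maps\<close>

text \<open>The hypothesis on the length is an instance of \<open>length_garside\<close>, which itself follows from
  this recursion by induction on the word.\<close>

lemma garside_Cons_aux:
  assumes "length (garside r k (length as) as) = length as"
  shows "garside r k (Suc (length as)) (a # as) =
      lam_list r a (garside r k (length as) as)
        @ [k (rho_list r (garside r k (length as) as) a)]"
proof (cases as)
  case Nil
  then show ?thesis by (simp add: at1_def at_pos_def)
next
  case (Cons b bs)
  define g where "g = garside r k (length as) as"
  have len: "length g = length as"
    using assms by (simp add: g_def)
  have "at_pos (length as) (garside r k (length as)) 2 (a # as) = a # g"
    by (simp add: at_pos_def g_def)
  then have "garside r k (Suc (length as)) (a # as) =
      at1 k (Suc (length as)) (fold (at2 r) [1..<Suc (length as)] (a # g))"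
    by (simp add: Cons)
  also have "fold (at2 r) [1..<Suc (length as)] (a # g) = lam_list r a g @ [rho_list r g a]"
    using fold_at2_eq_lam_list_rho_list[of r "[]" g a] len by simp
  also have "at1 k (Suc (length as)) \<dots> = lam_list r a g @ [k (rho_list r g a)]"
    using len by (simp add: at1_def at_pos_def)
  finally show ?thesis
    by (simp add: g_def)
qed

lemma length_garside [simp]: "length (garside r k (length as) as) = length as"
  by (induction as) (simp_all add: garside_Cons_aux)

lemmas garside_Cons = garside_Cons_aux[OF length_garside]

lemma guitar_Cons:
  "guitar r k (Suc (length as)) (a # as) =
     rho_list r (garside r k (length as) as) a # guitar r k (length as) as"
proof -
  have "[1..<Suc (Suc (length as))] = 1 # map Suc [1..<Suc (length as)]"
    by (simp add: upt_conv_Cons map_Suc_upt del: upt_Suc)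
  moreover have "(a # as) ! j = as ! (j - 1)" if "j \<in> set [1..<Suc (length as)]" for j
    using that by (auto simp: nth_Cons')
  ultimately show ?thesis
    by (simp add: guitar_def del: upt_Suc)
qed

lemma length_guitar [simp]: "length (guitar r k n as) = n"
  by (simp add: guitar_def)

section \<open>Intertwining relations\<close>

text \<open>This is where right non-degeneracy enters: the inverse in the derived solution cancels.\<close>

lemma derived_solution_conjugate:
  assumes "right_nondegenerate r"
  shows "derived_solution r k (rho r (k b) a, b) =
      (rho r (k (rho r b a)) (lam r a b), rho r b a)"
proof -
  have "inv (rho r (k b)) (rho r (k b) a) = a"
    using assms by (simp add: right_nondegenerate_def bij_is_inj)
  then show ?thesis
    by (simp add: derived_solution_def Let_def)
qed

text \<open>For \<open>pre = []\<close> this is the reflection equation for the pair left over after passing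
  \<open>(a, b)\<close> through \<open>\<Delta>(zs)\<close>.  A letter added in front is passed through the image under \<open>\<Delta>\<close> of
  the remaining word, and this commutes with applying \<open>r\<close> inside that image.\<close>

lemma garside_at2:
  assumes yb: "yb_solution r" and refl: "reflection r k"
  shows "garside r k (length (pre @ a # b # zs)) (pre @ lam r a b # rho r b a # zs) =
      at2 r (Suc (length zs)) (garside r k (length (pre @ a # b # zs)) (pre @ a # b # zs))"
proof (induction pre)
  case Nil
  define g where "g = garside r k (length zs) zs"
  \<comment> \<open>what remains of \<open>a\<close> and \<open>b\<close> after passing through \<open>\<Delta>(zs)\<close>\<close>
  define a2 b1 where "a2 = rho_list r (lam_list r b g) a" and "b1 = rho_list r g b"
  have len: "length g = length zs"
    by (simp add: g_def)
  have expand: "garside r k (Suc (Suc (length zs))) (x # y # zs) =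
      lam_list r x (lam_list r y g)
        @ [lam r (rho_list r (lam_list r y g) x) (k (rho_list r g y)),
           k (rho r (k (rho_list r g y)) (rho_list r (lam_list r y g) x))]" for x y
    using garside_Cons[of r k "y # zs" x] garside_Cons[of r k zs y]
    by (simp add: g_def del: garside.simps)
  have "garside r k (Suc (Suc (length zs))) (lam r a b # rho r b a # zs) =
      lam_list r a (lam_list r b g)
        @ [lam r (lam r a2 b1) (k (rho r b1 a2)), k (rho r (k (rho r b1 a2)) (lam r a2 b1))]"
    unfolding expand a2_def b1_def lam_list_pair[OF yb] rho_list_pair[OF yb] by simp
  also have "\<dots> = at2 r (Suc (length zs)) (garside r k (Suc (Suc (length zs))) (a # b # zs))"
    using at2_append_Cons[of r "lam_list r a (lam_list r b g)" "lam r a2 (k b1)"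
        "k (rho r (k b1) a2)" "[]"]
    unfolding expand a2_def[symmetric] b1_def[symmetric]
    by (simp add: len reflection_coordinates[OF refl])
  finally show ?case
    by (simp del: garside.simps)
next
  case (Cons c pre)
  define w where "w = pre @ a # b # zs"
  define w' where "w' = pre @ lam r a b # rho r b a # zs"
  define g where "g = garside r k (length w) w"
  have len: "length w' = length w"
    by (simp add: w_def w'_def)
  have idx: "1 \<le> Suc (length zs)" "Suc (length zs) < length g"
    by (simp_all add: g_def w_def del: length_append)
      (simp_all add: w_def)
  have IH: "garside r k (length w) w' = at2 r (Suc (length zs)) g"
    using Cons by (simp add: g_def w_def w'_def del: garside.simps)
  have "garside r k (Suc (length w)) (c # w') =
      at2 r (Suc (length zs)) (garside r k (Suc (length w)) (c # w))"
    using garside_Cons[of r k w' c] garside_Cons[of r k w c] idx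
    by (simp add: len IH g_def[symmetric] lam_list_at2[OF yb] rho_list_at2[OF yb] at2_append
        del: garside.simps)
  then show ?case
    by (simp add: w_def w'_def del: garside.simps)
qed

lemma guitar_at2:
  assumes yb: "yb_solution r" and rnd: "right_nondegenerate r" and refl: "reflection r k"
  shows "guitar r k (length (pre @ a # b # zs)) (pre @ lam r a b # rho r b a # zs) =
      at2 (derived_solution r k) (Suc (length pre))
        (guitar r k (length (pre @ a # b # zs)) (pre @ a # b # zs))"
proof (induction pre)
  case Nil
  define g where "g = garside r k (length zs) zs"
  have expand: "guitar r k (Suc (Suc (length zs))) (x # y # zs) =
      rho r (k (rho_list r g y)) (rho_list r (lam_list r y g) x)
        # rho_list r g y # guitar r k (length zs) zs" for x y
    using guitar_Cons[of r k "y # zs" x] guitar_Cons[of r k zs y] garside_Cons[of r k zs y]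
    by (simp add: g_def del: garside.simps)
  show ?case
    by (simp add: expand at2_def at_pos_def derived_solution_conjugate[OF rnd]
        rho_list_pair[OF yb])
next
  case (Cons c pre)
  define w where "w = pre @ a # b # zs"
  define w' where "w' = pre @ lam r a b # rho r b a # zs"
  define g where "g = garside r k (length w) w"
  have len: "length w' = length w"
    by (simp add: w_def w'_def)
  have idx: "1 \<le> Suc (length zs)" "Suc (length zs) < length g"
    by (simp_all add: g_def w_def del: length_append)
      (simp_all add: w_def)
  have "garside r k (length w) w' = at2 r (Suc (length zs)) g"
    using garside_at2[OF yb refl, of pre a b zs] by (simp add: g_def w_def w'_def)
  then have head: "rho_list r (garside r k (length w) w') c = rho_list r g c"
    by (simp only: rho_list_at2[OF yb idx])
  have "guitar r k (Suc (length w)) (c # w') =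
      rho_list r g c # guitar r k (length w) w'"
    using guitar_Cons[of r k w' c] by (simp add: len head del: garside.simps)
  also have "\<dots> = rho_list r g c
      # at2 (derived_solution r k) (Suc (length pre)) (guitar r k (length w) w)"
    using Cons by (simp add: w_def w'_def)
  also have "\<dots> = at2 (derived_solution r k) (Suc (Suc (length pre)))
      (guitar r k (Suc (length w)) (c # w))"
    unfolding guitar_Cons g_def by (rule at2_Cons[symmetric]) (simp_all add: w_def)
  finally show ?case
    by (simp add: w_def w'_def)
qed

theorem theorem1p8:
  fixes r :: "'a \<times> 'a \<Rightarrow> 'a \<times> 'a" and k :: "'a \<Rightarrow> 'a" and n i :: nat
  assumes "yb_solution r"
    and "right_nondegenerate r"
    and "reflection r k"
    and "1 \<le> i" and "i < n"
  shows "(\<forall>as. length as = n \<longrightarrow>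
            (guitar r k n \<circ> at2 r i) as = (at2 (derived_solution r k) i \<circ> guitar r k n) as)
       \<and> (\<forall>as. length as = n \<longrightarrow>
            (garside r k n \<circ> at2 r i) as = (at2 r (n - i) \<circ> garside r k n) as)"
proof (intro conjI allI impI)
  fix as :: "'a list"
  assume len: "length as = n"
  then obtain pre a b zs where as: "as = pre @ a # b # zs" and i: "i = Suc (length pre)"
    using at2_index_cases[of i as] assms(4,5) by blast
  have at2_as: "at2 r i as = pre @ lam r a b # rho r b a # zs"
    by (simp add: as i at2_append_Cons)
  have n: "n = length (pre @ a # b # zs)"
    using len as by simp
  show "(guitar r k n \<circ> at2 r i) as = (at2 (derived_solution r k) i \<circ> guitar r k n) as"
    unfolding o_apply at2_as unfolding n i as by (rule guitar_at2[OF assms(1-3)])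
next
  fix as :: "'a list"
  assume len: "length as = n"
  then obtain pre a b zs where as: "as = pre @ a # b # zs" and i: "i = Suc (length pre)"
    using at2_index_cases[of i as] assms(4,5) by blast
  have at2_as: "at2 r i as = pre @ lam r a b # rho r b a # zs"
    by (simp add: as i at2_append_Cons)
  have n: "n = length (pre @ a # b # zs)"
    using len as by simp
  have "n - i = Suc (length zs)"
    by (simp add: n i)
  then show "(garside r k n \<circ> at2 r i) as = (at2 r (n - i) \<circ> garside r k n) as"
    using garside_at2[OF assms(1,3), of pre a b zs] at2_as n as by simp
qed

end
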